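(* Let $q,x\in\mathbb{R}^d$ be unit vectors with angle $\theta_{qx}=\arccos(q\cdot x)\in(0,\pi)\setminus\{\pi/2\}$. Let $r$ be a standard Gaussian vector in $\mathbb{R}^d$, and let $r_q=r\cdot q$. Then $$\mathbb{P}\left(h_r(x)\ne h_r(q)\mid r_q\right)=\frac12-\frac12\operatorname{erf}\left(\frac{|r_q|}{\sqrt2\tan(\theta_{qx})}\right),$$ where $\operatorname{erf}$ is the error function.
   Context: For $r,v\in\mathbb{R}^d$, $h_r(v)=0$ if $r\cdot v\le0$ and $h_r(v)=1$ otherwise. *)

theory Defs
  imports "HOL-Probability.Probability"
begin

definition hyperplane_hash :: "real ^ 'd \<Rightarrow> real ^ 'd \<Rightarrow> nat" where
  "hyperplane_hash r v = (if r \<bullet> v \<le> 0 then 0 else 1)"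

text \<open>The interval integral is oriented, so \<open>erf\<close> is defined, and odd, on the whole real line.\<close>

definition erf :: "real \<Rightarrow> real" where
  "erf x = 2 / sqrt pi * (LBINT t=0..x. exp (- t\<^sup>2))"

definition std_gaussian_vector :: "'a measure \<Rightarrow> ('a \<Rightarrow> real ^ 'd) \<Rightarrow> bool" where
  "std_gaussian_vector M r \<longleftrightarrow>
     prob_space.indep_vars M (\<lambda>_. borel) (\<lambda>i \<omega>. r \<omega> $ i) UNIV \<and>
     (\<forall>i. distributed M lborel (\<lambda>\<omega>. r \<omega> $ i) (\<lambda>t. ennreal (std_normal_density t)))"

text \<open>
  Conditional probability of an event given a random variable \<open>X\<close>: the conditional expectation
  of the indicator of the event with respect to the sigma-algebra generated by \<open>X\<close>.
  It is determined only up to almost sure equality.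
\<close>

definition cond_prob_given :: "'a measure \<Rightarrow> ('a \<Rightarrow> bool) \<Rightarrow> ('a \<Rightarrow> real) \<Rightarrow> 'a \<Rightarrow> real" where
  "cond_prob_given M P X =
     real_cond_exp M (vimage_algebra (space M) X borel) (indicator {\<omega> \<in> space M. P \<omega>})"

end

theory Submission
  imports Defs
begin

text \<open>
  Write \<open>x = cos \<theta> q + sin \<theta> w\<close> with \<open>w\<close> a unit vector orthogonal to \<open>q\<close>. The law of \<open>r\<close> has a
  density depending only on the norm, so it is rotation invariant; rotating \<open>q\<close> onto a coordinate
  axis shows that \<open>r \<bullet> q\<close> and \<open>r \<bullet> w\<close> are independent standard normals. Hence conditioning on
  \<open>r \<bullet> q = y\<close> amounts to freezing \<open>y\<close>, and the hashes differ iff the standard normal variable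
  \<open>r \<bullet> w\<close> lies in the tail beyond \<open>\<bar>y\<bar> / tan \<theta>\<close> on the side determined by the sign of \<open>y\<close>.
\<close>

subsection \<open>Rotation invariance of the Gaussian vector\<close>

lemma nn_integral_lborel_shift:
  fixes f :: "'a::euclidean_space \<Rightarrow> ennreal"
  assumes [measurable]: "f \<in> borel_measurable borel"
  shows "(\<integral>\<^sup>+y. f (c + y) \<partial>lborel) = (\<integral>\<^sup>+y. f y \<partial>lborel)"
proof -
  have "(\<integral>\<^sup>+y. f y \<partial>lborel) = (\<integral>\<^sup>+y. f y \<partial>distr lborel borel ((+) c))"
    by (simp add: lborel_distr_plus)
  also have "\<dots> = (\<integral>\<^sup>+y. f (c + y) \<partial>lborel)"
    by (subst nn_integral_distr) auto
  finally show ?thesis ..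
qed

lemma nn_integral_lborel_uminus:
  fixes f :: "'a::euclidean_space \<Rightarrow> ennreal"
  assumes [measurable]: "f \<in> borel_measurable borel"
  shows "(\<integral>\<^sup>+y. f (- y) \<partial>lborel) = (\<integral>\<^sup>+y. f y \<partial>lborel)"
proof -
  have "(lborel :: 'a measure) = density (distr lborel borel uminus) (\<lambda>_. 1)"
    using lborel_affine[of "-1" "0::'a"] by simp
  then have "(\<integral>\<^sup>+y. f y \<partial>lborel) = (\<integral>\<^sup>+y. f y \<partial>distr (lborel :: 'a measure) borel uminus)"
    by (metis density_1)
  also have "\<dots> = (\<integral>\<^sup>+y. f (- y) \<partial>lborel)"
    by (subst nn_integral_distr) auto
  finally show ?thesis ..
qed

text \<open>
  Uniqueness of translation-invariant measures up to scaling, with the constants cross-multiplied.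
  The library's \<open>measure_orthogonal_image\<close> needs a wellordered index type, which is not available
  here; instead the scaling factor of a rotated Lebesgue measure is read off the unit ball.
\<close>

lemma translation_invariant_nn_integral:
  fixes f g :: "'a::euclidean_space \<Rightarrow> ennreal"
  assumes N: "sigma_finite_measure N" and sets[measurable_cong]: "sets N = sets borel"
    and inv: "\<And>c h. h \<in> borel_measurable borel \<Longrightarrow> (\<integral>\<^sup>+y. h (c + y) \<partial>N) = (\<integral>\<^sup>+y. h y \<partial>N)"
    and [measurable]: "f \<in> borel_measurable borel" "g \<in> borel_measurable borel"
  shows "(\<integral>\<^sup>+x. f x \<partial>N) * (\<integral>\<^sup>+y. g y \<partial>lborel) = (\<integral>\<^sup>+x. g x \<partial>N) * (\<integral>\<^sup>+y. f y \<partial>lborel)"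
proof -
  interpret N: sigma_finite_measure N by fact
  interpret P: pair_sigma_finite N "lborel :: 'a measure" ..
  have "(\<integral>\<^sup>+x. f x \<partial>N) * (\<integral>\<^sup>+y. g y \<partial>lborel) = (\<integral>\<^sup>+x. f x * (\<integral>\<^sup>+y. g (x + y) \<partial>lborel) \<partial>N)"
    by (simp add: nn_integral_lborel_shift nn_integral_multc)
  also have "\<dots> = (\<integral>\<^sup>+x. \<integral>\<^sup>+y. f x * g (x + y) \<partial>lborel \<partial>N)"
    by (simp add: nn_integral_cmult)
  also have "\<dots> = (\<integral>\<^sup>+y. \<integral>\<^sup>+x. f x * g (x + y) \<partial>N \<partial>lborel)"
    by (rule P.Fubini'[symmetric]) simp
  also have "\<dots> = (\<integral>\<^sup>+y. \<integral>\<^sup>+x. f (x - y) * g x \<partial>N \<partial>lborel)"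
  proof (rule nn_integral_cong)
    fix y :: 'a
    have "(\<integral>\<^sup>+x. f (- y + x) * g (- y + x + y) \<partial>N) = (\<integral>\<^sup>+x. f x * g (x + y) \<partial>N)"
      by (rule inv) simp
    then show "(\<integral>\<^sup>+x. f x * g (x + y) \<partial>N) = (\<integral>\<^sup>+x. f (x - y) * g x \<partial>N)"
      by simp
  qed
  also have "\<dots> = (\<integral>\<^sup>+x. \<integral>\<^sup>+y. f (x - y) * g x \<partial>lborel \<partial>N)"
    by (rule P.Fubini') simp
  also have "\<dots> = (\<integral>\<^sup>+x. (\<integral>\<^sup>+y. f (x - y) \<partial>lborel) * g x \<partial>N)"
    by (simp add: nn_integral_multc)
  also have "\<dots> = (\<integral>\<^sup>+x. (\<integral>\<^sup>+y. f y \<partial>lborel) * g x \<partial>N)"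
  proof (rule nn_integral_cong)
    fix x :: 'a
    have "(\<integral>\<^sup>+y. f (x - y) \<partial>lborel) = (\<integral>\<^sup>+y. f (x + y) \<partial>lborel)"
      using nn_integral_lborel_uminus[of "\<lambda>y. f (x + y)"] by simp
    then show "(\<integral>\<^sup>+y. f (x - y) \<partial>lborel) * g x = (\<integral>\<^sup>+y. f y \<partial>lborel) * g x"
      by (simp add: nn_integral_lborel_shift)
  qed
  also have "\<dots> = (\<integral>\<^sup>+x. g x \<partial>N) * (\<integral>\<^sup>+y. f y \<partial>lborel)"
    by (simp add: nn_integral_cmult) (rule mult.commute)
  finally show ?thesis .
qed

lemma lborel_distr_orthogonal_transformation:
  fixes T :: "'a::euclidean_space \<Rightarrow> 'a"
  assumes T: "orthogonal_transformation T"
  shows "distr lborel borel T = lborel"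
proof -
  have lin: "linear T" using T by (rule orthogonal_transformation_linear)
  have [measurable]: "T \<in> borel_measurable borel"
    by (intro borel_measurable_continuous_onI linear_continuous_on linear_conv_bounded_linear[THEN iffD1] lin)
  let ?N = "distr lborel borel T"
  have invT: "orthogonal_transformation (inv T)" using T by (rule orthogonal_transformation_inv)
  have [measurable]: "inv T \<in> borel_measurable borel"
    by (intro borel_measurable_continuous_onI linear_continuous_on linear_conv_bounded_linear[THEN iffD1]
        orthogonal_transformation_linear invT)
  have TinvT: "T (inv T x) = x" for x
    using orthogonal_transformation_surj[OF T] by (rule surj_f_inv_f)
  have invTT: "inv T (T x) = x" for x
    using orthogonal_transformation_inj[OF T] by (rule inv_f_f)
  have "sigma_finite_measure (distr (distr lborel borel T) borel (inv T))"
    by (subst distr_distr) (simp_all add: o_def invTT distr_id2 lborel.sigma_finite_measure_axioms)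
  then have sf: "sigma_finite_measure ?N"
    by (rule sigma_finite_measure_distr) simp
  let ?B = "ball 0 1 :: 'a set"
  have "emeasure ?N ?B = emeasure lborel (T -` ?B)"
    by (subst emeasure_distr) auto
  also have "T -` ?B = ?B"
    using T by (auto simp: orthogonal_transformation_norm)
  finally have B: "emeasure ?N ?B = emeasure lborel ?B" .
  have inv: "(\<integral>\<^sup>+y. h (c + y) \<partial>?N) = (\<integral>\<^sup>+y. h y \<partial>?N)"
    if [measurable]: "h \<in> borel_measurable borel" for c and h :: "'a \<Rightarrow> ennreal"
  proof -
    have "(\<integral>\<^sup>+y. h (c + y) \<partial>?N) = (\<integral>\<^sup>+y. h (T (inv T c + y)) \<partial>lborel)"
      by (subst nn_integral_distr) (auto simp: linear_add[OF lin] TinvT)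
    also have "\<dots> = (\<integral>\<^sup>+y. h (T y) \<partial>lborel)"
      by (rule nn_integral_lborel_shift) simp
    also have "\<dots> = (\<integral>\<^sup>+y. h y \<partial>?N)"
      by (subst nn_integral_distr) auto
    finally show ?thesis .
  qed
  have fin: "emeasure lborel ?B < \<infinity>" by (rule emeasure_bounded_finite) simp
  have pos: "emeasure lborel ?B \<noteq> 0"
  proof
    assume "emeasure lborel ?B = 0"
    then have "?B \<in> null_sets lborel" by auto
    then have "negligible ?B"
      using negligible_iff_null_sets null_sets_completionI by blast
    then show False using open_not_negligible[of ?B] by auto
  qed
  show ?thesis
  proof (rule measure_eqI)
    fix A assume "A \<in> sets ?N"
    then have [measurable]: "A \<in> sets borel" by simp
    have "emeasure ?N A * emeasure lborel ?B = emeasure ?N ?B * emeasure lborel A"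
      using translation_invariant_nn_integral[OF sf _ inv, of "indicator A" "indicator ?B"] by (simp add: borel_measurable_indicator)
    then have "emeasure lborel ?B * emeasure ?N A = emeasure lborel ?B * emeasure lborel A"
      by (simp add: B mult.commute)
    then show "emeasure ?N A = emeasure lborel A"
      using fin pos by (auto simp: ennreal_mult_cancel_left less_top)
  qed simp
qed

lemma prod_Basis_axis: "(\<Prod>b\<in>Basis. f b) = (\<Prod>i\<in>(UNIV::'d::finite set). f (axis i (1::real)))"
proof -
  have "inj (\<lambda>i::'d. axis i (1::real))" by (auto simp: inj_on_def axis_eq_axis)
  moreover have "(\<Prod>b\<in>Basis. f b) = (\<Prod>b\<in>range (\<lambda>i::'d. axis i (1::real)). f b)"
    by (rule prod.cong) (auto simp: Basis_vec_def)
  ultimately show ?thesis by (simp add: prod.reindex)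
qed

lemma prod_std_normal_density:
  fixes v :: "real ^ 'd"
  shows "(\<Prod>i\<in>UNIV. std_normal_density (v $ i)) = (1 / sqrt (2 * pi)) ^ CARD('d) * exp (- (norm v)\<^sup>2 / 2)"
proof -
  have "(norm v)\<^sup>2 = (\<Sum>i\<in>UNIV. (v $ i)\<^sup>2)"
    by (simp add: norm_vec_def L2_set_def sum_nonneg)
  then show ?thesis
    unfolding std_normal_density_def prod.distrib exp_sum[OF finite, symmetric]
    by (simp add: sum_negf sum_divide_distrib)
qed

lemma std_gaussian_vector_measurable:
  assumes "std_gaussian_vector M r"
  shows "r \<in> borel_measurable M"
proof -
  have "(\<lambda>\<omega>. r \<omega> $ i) \<in> borel_measurable M" for i
    using assms distributed_measurable[of M lborel "\<lambda>\<omega>. r \<omega> $ i"] 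
    by (auto simp: std_gaussian_vector_def)
  then show ?thesis
    by (subst borel_measurable_euclidean_space) (auto simp: Basis_vec_def inner_axis)
qed

lemma distr_std_gaussian_vector:
  fixes r :: "'a \<Rightarrow> real ^ 'd"
  assumes M: "prob_space M" and r: "std_gaussian_vector M r"
  shows "distr M borel r = density lborel (\<lambda>v. ennreal ((1 / sqrt (2 * pi)) ^ CARD('d) * exp (- (norm v)\<^sup>2 / 2)))"
    (is "?L = ?R")
proof (rule measure_eqI_generator_eq)
  interpret prob_space M by fact
  have [measurable]: "r \<in> borel_measurable M" using r by (rule std_gaussian_vector_measurable)
  let ?E = "range (\<lambda>(a, b). box a b::(real ^ 'd) set)"
  show "Int_stable ?E"
    by (auto simp: Int_stable_def box_Int_box)
  show "?E \<subseteq> Pow UNIV" "sets ?L = sigma_sets UNIV ?E" "sets ?R = sigma_sets UNIV ?E"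
    by (simp_all add: borel_eq_box)
  let ?A = "\<lambda>n::nat. box (- (real n *\<^sub>R One)) (real n *\<^sub>R One) :: (real ^ 'd) set"
  show "range ?A \<subseteq> ?E" "(\<Union>i. ?A i) = UNIV"
    unfolding UN_box_eq_UNIV by auto
  show "emeasure ?L (?A i) \<noteq> \<infinity>" for i
    by (subst emeasure_distr) auto
  fix X assume "X \<in> ?E"
  then obtain a b where X: "X = box a b" by auto
  let ?I = "\<lambda>i. {a $ i<..<b $ i}"
  have box: "indicator (box a b) v = (\<Prod>i\<in>UNIV. indicator (?I i) (v $ i) :: ennreal)" for v
    by (auto simp: indicator_def mem_box_cart prod_zero_iff split: if_splits) 
  have "emeasure ?L X = prob (\<Inter>i\<in>UNIV. (\<lambda>\<omega>. r \<omega> $ i) -` ?I i \<inter> space M)"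
    by (subst emeasure_distr) (auto simp: X emeasure_eq_measure mem_box_cart intro!: arg_cong[where f=prob])
  also have "\<dots> = (\<Prod>i\<in>UNIV. prob ((\<lambda>\<omega>. r \<omega> $ i) -` ?I i \<inter> space M))"
    using r by (subst indep_varsD_finite[where M'="\<lambda>_. borel"]) (auto simp: std_gaussian_vector_def)
  also have "\<dots> = (\<Prod>i\<in>UNIV. emeasure M ((\<lambda>\<omega>. r \<omega> $ i) -` ?I i \<inter> space M))"
    by (simp add: emeasure_eq_measure prod_ennreal)
  also have "\<dots> = (\<Prod>i\<in>UNIV. \<integral>\<^sup>+t. ennreal (std_normal_density t) * indicator (?I i) t \<partial>lborel)"
    using r by (intro prod.cong refl distributed_emeasure) (auto simp: std_gaussian_vector_def)
  also have "\<dots> = (\<Prod>e\<in>Basis. \<integral>\<^sup>+t. ennreal (std_normal_density t) * indicator {a \<bullet> e<..<b \<bullet> e} t \<partial>lborel)"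
    by (simp add: prod_Basis_axis inner_axis)
  also have "\<dots> = (\<integral>\<^sup>+v. (\<Prod>e\<in>Basis. ennreal (std_normal_density (v \<bullet> e)) * indicator {a \<bullet> e<..<b \<bullet> e} (v \<bullet> e)) \<partial>lborel)"
    by (rule nn_integral_lborel_prod[symmetric]) auto
  also have "\<dots> = (\<integral>\<^sup>+v. (\<Prod>i\<in>UNIV. ennreal (std_normal_density (v $ i))) * indicator X v \<partial>lborel)"
    by (simp add: prod_Basis_axis inner_axis prod.distrib X box)
  also have "\<dots> = emeasure ?R X"
    by (subst emeasure_density) (auto simp: X prod_ennreal prod_std_normal_density)
  finally show "emeasure ?L X = emeasure ?R X" .
qed

lemma std_gaussian_vector_orthogonal_transformation:
  fixes r :: "'a \<Rightarrow> real ^ 'd" and T :: "real ^ 'd \<Rightarrow> real ^ 'd"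
  assumes M: "prob_space M" and r: "std_gaussian_vector M r" and T: "orthogonal_transformation T"
  shows "std_gaussian_vector M (\<lambda>\<omega>. T (r \<omega>))"
proof -
  interpret prob_space M by fact
  have [measurable]: "r \<in> borel_measurable M" using r by (rule std_gaussian_vector_measurable)
  have [measurable]: "T \<in> borel_measurable borel"
    by (intro borel_measurable_continuous_onI linear_continuous_on linear_conv_bounded_linear[THEN iffD1]
        orthogonal_transformation_linear T)
  define g where "g v = ennreal ((1 / sqrt (2 * pi)) ^ CARD('d) * exp (- (norm v)\<^sup>2 / 2))" for v :: "real ^ 'd"
  have [measurable]: "g \<in> borel_measurable borel" unfolding g_def[abs_def] by simp
  have gT: "g \<circ> T = g" by (simp add: fun_eq_iff g_def orthogonal_transformation_norm[OF T])
  have rg: "distr M borel r = density lborel g"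
    unfolding g_def by (rule distr_std_gaussian_vector[OF M r])
  have "distr M borel (\<lambda>\<omega>. T (r \<omega>)) = distr (distr M borel r) borel T"
    by (subst distr_distr) (auto simp: o_def)
  also have "\<dots> = distr (density lborel (g \<circ> T)) borel T"
    by (simp add: rg gT)
  also have "\<dots> = density (distr lborel borel T) g"
    by (subst density_distr) (auto simp: o_def)
  finally have eq: "distr M borel (\<lambda>\<omega>. T (r \<omega>)) = distr M borel r"
    by (simp add: lborel_distr_orthogonal_transformation[OF T] rg)
  have [measurable]: "(\<lambda>v::real^'d. \<lambda>i\<in>UNIV. v $ i) \<in> measurable borel (\<Pi>\<^sub>M i\<in>UNIV. borel)"
    by (rule measurable_restrict) simp
  have push: "distr M N (\<lambda>\<omega>. h (T (r \<omega>))) = distr M N (\<lambda>\<omega>. h (r \<omega>))"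
    if [measurable]: "h \<in> measurable borel N" for h and N :: "'n measure"
  proof -
    have "distr (distr M borel (\<lambda>\<omega>. T (r \<omega>))) N h = distr (distr M borel r) N h"
      by (simp only: eq)
    then show ?thesis by (simp add: distr_distr o_def)
  qed
  have nth: "(\<lambda>v::real^'d. v $ i) \<in> borel_measurable borel" for i
    by (intro borel_measurable_continuous_onI continuous_intros)
  have [measurable]: "(\<lambda>\<omega>. T (r \<omega>) $ i) \<in> borel_measurable M"
    "(\<lambda>\<omega>. r \<omega> $ i) \<in> borel_measurable M" for i
    by (rule measurable_compose[OF _ nth]; measurable)+
  have 1: "distributed M lborel (\<lambda>\<omega>. T (r \<omega>) $ i) (\<lambda>t. ennreal (std_normal_density t))" for i
    using r push[of "\<lambda>v. v $ i" lborel] by (auto simp: std_gaussian_vector_def distributed_def)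
  have "indep_vars (\<lambda>_. borel) (\<lambda>i \<omega>. r \<omega> $ i) UNIV"
    using r by (simp add: std_gaussian_vector_def)
  then have "distr M (\<Pi>\<^sub>M i\<in>UNIV. borel) (\<lambda>\<omega>. \<lambda>i\<in>UNIV. r \<omega> $ i) = (\<Pi>\<^sub>M i\<in>UNIV. distr M borel (\<lambda>\<omega>. r \<omega> $ i))"
    by (subst (asm) indep_vars_iff_distr_eq_PiM) auto
  then have "distr M (\<Pi>\<^sub>M i\<in>UNIV. borel) (\<lambda>\<omega>. \<lambda>i\<in>UNIV. T (r \<omega>) $ i) = (\<Pi>\<^sub>M i\<in>UNIV. distr M borel (\<lambda>\<omega>. T (r \<omega>) $ i))"
    using push[of "\<lambda>v. \<lambda>i\<in>UNIV. v $ i" "\<Pi>\<^sub>M i\<in>UNIV. borel"] push[of "\<lambda>v. v $ _" borel]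
    by (simp add: nth)
  then have "indep_vars (\<lambda>_. borel) (\<lambda>i \<omega>. T (r \<omega>) $ i) UNIV"
    by (subst indep_vars_iff_distr_eq_PiM) auto
  with 1 show ?thesis by (simp add: std_gaussian_vector_def)
qed

lemma orthogonal_transformation_to_axis:
  fixes q :: "real ^ 'd"
  assumes "norm q = 1"
  obtains T :: "real ^ 'd \<Rightarrow> real ^ 'd" and k where "orthogonal_transformation T" "T q = axis k 1"
proof -
  obtain k :: 'd where True by simp
  obtain T :: "real ^ 'd \<Rightarrow> real ^ 'd" where "orthogonal_transformation T" "T q = axis k 1"
    using orthogonal_transformation_exists_1[of q "axis k 1"] assms by auto
  then show ?thesis by (rule that)
qed

lemma std_gaussian_vector_inner_distributed:
  fixes r :: "'a \<Rightarrow> real ^ 'd"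
  assumes M: "prob_space M" and r: "std_gaussian_vector M r" and w: "norm w = 1"
  shows "distributed M lborel (\<lambda>\<omega>. r \<omega> \<bullet> w) (\<lambda>t. ennreal (std_normal_density t))"
proof -
  obtain T :: "real ^ 'd \<Rightarrow> real ^ 'd" and k where T: "orthogonal_transformation T" and Tw: "T w = axis k 1"
    using orthogonal_transformation_to_axis[OF w] by blast
  have "r \<omega> \<bullet> w = T (r \<omega>) $ k" for \<omega>
    using T unfolding orthogonal_transformation_def by (metis Tw inner_axis inner_real_def mult.right_neutral)
  then show ?thesis
    using std_gaussian_vector_orthogonal_transformation[OF M r T] by (simp add: std_gaussian_vector_def)
qed

lemma std_gaussian_vector_inner_indep:
  fixes r :: "'a \<Rightarrow> real ^ 'd"
  assumes M: "prob_space M" and r: "std_gaussian_vector M r" and q: "norm q = 1" and qw: "q \<bullet> w = 0"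
  shows "prob_space.indep_var M borel (\<lambda>\<omega>. r \<omega> \<bullet> q) borel (\<lambda>\<omega>. r \<omega> \<bullet> w)"
proof -
  interpret prob_space M by fact
  obtain T :: "real ^ 'd \<Rightarrow> real ^ 'd" and k where T: "orthogonal_transformation T" and Tq: "T q = axis k 1"
    using orthogonal_transformation_to_axis[OF q] by blast
  have inner: "x \<bullet> y = T x \<bullet> T y" for x y using T by (simp add: orthogonal_transformation_def)
  have q_eq: "r \<omega> \<bullet> q = T (r \<omega>) $ k" for \<omega>
    by (simp add: inner[of "r \<omega>" q] Tq inner_axis)
  have "T w $ k = 0"
    using qw by (simp add: inner[of q w] Tq inner_axis')
  then have w_eq: "r \<omega> \<bullet> w = (\<Sum>i\<in>UNIV - {k}. T w $ i * T (r \<omega>) $ i)" for \<omega>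
    by (subst inner, simp add: inner_vec_def sum.remove[of UNIV k] mult.commute)
  define c where "c i = (if i = k then 1 else T w $ i)" for i
  have "indep_vars (\<lambda>_. borel) (\<lambda>i \<omega>. T (r \<omega>) $ i) UNIV"
    using std_gaussian_vector_orthogonal_transformation[OF M r T] by (simp add: std_gaussian_vector_def)
  then have "indep_vars (\<lambda>_. borel) (\<lambda>i \<omega>. c i * T (r \<omega>) $ i) UNIV"
    by (rule indep_vars_compose2[where Y="\<lambda>i x. c i * x"]) simp
  then have "indep_var borel (\<lambda>\<omega>. c k * T (r \<omega>) $ k) borel (\<lambda>\<omega>. \<Sum>i\<in>UNIV - {k}. c i * T (r \<omega>) $ i)"
    by (intro indep_vars_sum) (auto simp: insert_absorb)
  moreover have "(\<Sum>i\<in>UNIV - {k}. c i * T (r \<omega>) $ i) = r \<omega> \<bullet> w" for \<omega>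
    by (auto simp: w_eq c_def intro!: sum.cong)
  ultimately show ?thesis by (simp add: q_eq c_def)
qed

subsection \<open>Tails of the standard normal distribution\<close>

lemma erf_minus: "erf (- x) = - erf x"
proof -
  have "(LBINT t=0..ereal (- x). exp (- t\<^sup>2)) = (LBINT t=x..0. exp (- t\<^sup>2))"
    using interval_integral_reflect[of 0 "ereal (- x)" "\<lambda>t. exp (- t\<^sup>2)"] by simp
  also have "\<dots> = - (LBINT t=0..x. exp (- t\<^sup>2))"
    by (rule interval_integral_endpoints_reverse)
  finally show ?thesis by (simp add: erf_def)
qed

lemma prob_space_std_normal: "prob_space std_normal_distribution"
  by (rule prob_space_normal_density) simp

lemma std_normal_atMost_uminus:
  "measure std_normal_distribution {.. - a} = measure std_normal_distribution {a..}"
proof -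
  interpret prob_space std_normal_distribution by (rule prob_space_std_normal)
  have "distributed std_normal_distribution lborel (\<lambda>x. x) (\<lambda>t. ennreal (std_normal_density t))"
    by (simp add: distributed_def distr_id2)
  from normal_density_affine[OF this, of "-1" 0]
  have d: "distributed std_normal_distribution lborel uminus (\<lambda>t. ennreal (std_normal_density t))"
    by simp
  have "measure std_normal_distribution {.. - a} = measure (distr std_normal_distribution lborel uminus) {.. - a}"
    using d by (simp add: distributed_def)
  also have "\<dots> = measure std_normal_distribution {a..}"
    by (subst measure_distr) (auto intro!: arg_cong[where f="measure _"])
  finally show ?thesis .
qed

lemma std_normal_atLeast:
  "measure std_normal_distribution {a..} = measure std_normal_distribution {a<..}"
proof -
  interpret prob_space std_normal_distribution by (rule prob_space_std_normal)
  have "emeasure std_normal_distribution {a} = 0"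
    by (subst emeasure_density) (auto simp: nn_integral_0_iff_AE intro!: AE_I[of _ _ "{a}"])
  then have "measure std_normal_distribution {a} = 0" by (simp add: measure_def)
  moreover have "{a..} = {a} \<union> {a<..}" by auto
  ultimately show ?thesis
    using finite_measure_Union[of "{a}" "{a<..}"] by simp
qed

lemma std_normal_interval:
  assumes "0 \<le> a"
  shows "measure std_normal_distribution {0..a} = erf (a / sqrt 2) / 2"
proof -
  have sq: "(sqrt 2 * u)\<^sup>2 / 2 = u\<^sup>2" for u :: real
    by (simp add: power_mult_distrib)
  have "measure std_normal_distribution {0..a} = (LBINT t:{0..a}. std_normal_density t)"
    unfolding set_lebesgue_integral_def
    by (subst integral_eq_nn_integral) (auto simp: measure_def emeasure_density intro!: arg_cong[where f=enn2real] nn_integral_cong split: split_indicator)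
  also have "\<dots> = (LBINT t=ereal 0..ereal a. std_normal_density t)"
    using assms by (simp only: interval_integral_Icc)
  also have "\<dots> = (LBINT u=ereal 0..ereal (a / sqrt 2). sqrt 2 *\<^sub>R std_normal_density (sqrt 2 * u))"
    using interval_integral_substitution_finite[of 0 "a / sqrt 2" "\<lambda>u. sqrt 2 * u" "\<lambda>_. sqrt 2" std_normal_density] assms
    by (simp add: std_normal_density_def continuous_intros DERIV_cmult_Id)
  also have "(\<lambda>u. sqrt 2 *\<^sub>R std_normal_density (sqrt 2 * u)) = (\<lambda>u. 1 / sqrt pi * exp (- u\<^sup>2))"
    by (simp add: fun_eq_iff std_normal_density_def real_sqrt_mult sq)
  finally show ?thesis by (simp add: erf_def zero_ereal_def)
qed

lemma std_normal_greaterThan: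
  "measure std_normal_distribution {a<..} = 1 / 2 - 1 / 2 * erf (a / sqrt 2)"
proof -
  interpret prob_space std_normal_distribution by (rule prob_space_std_normal)
  let ?m = "measure std_normal_distribution"
  have compl: "?m {b<..} = 1 - ?m {..b}" for b
    using prob_compl[of "{..b}"] by (simp add: Compl_eq_Diff_UNIV[symmetric] ivl_disj_un)
  have half: "?m {0..} = 1 / 2"
    using compl[of 0] std_normal_atMost_uminus[of 0] std_normal_atLeast[of 0] by simp
  have pos: "?m {b<..} = 1 / 2 - 1 / 2 * erf (b / sqrt 2)" if "0 \<le> b" for b
  proof -
    have "{0..} = {0..b} \<union> {b<..}" "{0..b} \<inter> {b<..} = {}" using that by auto
    then have "?m {0..} = ?m {0..b} + ?m {b<..}"
      using finite_measure_Union[of "{0..b}" "{b<..}"] by simp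
    then show ?thesis using half std_normal_interval[OF that] by simp
  qed
  show ?thesis
  proof (cases "0 \<le> a")
    case False
    then have "?m {- a<..} = 1 / 2 + 1 / 2 * erf (a / sqrt 2)"
      using pos[of "- a"] by (simp add: erf_minus)
    then show ?thesis
      using compl[of a] std_normal_atMost_uminus[of "- a"] std_normal_atLeast[of "- a"] by simp
  qed (rule pos)
qed

lemma std_normal_atMost:
  "measure std_normal_distribution {.. - a} = 1 / 2 - 1 / 2 * erf (a / sqrt 2)"
  by (simp add: std_normal_atMost_uminus std_normal_atLeast std_normal_greaterThan)

subsection \<open>Conditioning on one of two independent variables\<close>

lemma (in prob_space) real_cond_exp_indep_var:
  fixes X Y :: "'a \<Rightarrow> real" and K :: "real \<times> real \<Rightarrow> real"
  assumes indep: "indep_var borel X borel Y"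
    and K[measurable]: "K \<in> borel_measurable (borel \<Otimes>\<^sub>M borel)" and bounded: "\<And>p. \<bar>K p\<bar> \<le> B"
  shows "AE \<omega> in M. real_cond_exp M (vimage_algebra (space M) X borel) (\<lambda>\<omega>. K (X \<omega>, Y \<omega>)) \<omega>
    = (\<integral>y. K (X \<omega>, y) \<partial>distr M borel Y)"
proof -
  have [measurable]: "X \<in> borel_measurable M" "Y \<in> borel_measurable M"
    using indep by (auto dest: indep_var_rv1 indep_var_rv2)
  let ?F = "vimage_algebra (space M) X borel"
  let ?DX = "distr M borel X" and ?DY = "distr M borel Y"
  interpret DX: prob_space ?DX by (rule prob_space_distr) simp
  interpret DY: prob_space ?DY by (rule prob_space_distr) simp
  interpret P: pair_prob_space ?DX ?DY ..
  have F: "subalgebra M ?F"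
    by (auto simp: subalgebra_def sets_vimage_algebra2)
  interpret finite_measure_subalgebra M ?F
    by unfold_locales (rule F)
  define g where "g x = (\<integral>y. K (x, y) \<partial>?DY)" for x
  have [measurable]: "g \<in> borel_measurable borel"
    unfolding g_def by (rule DY.borel_measurable_lebesgue_integral) simp
  have g_bound: "\<bar>g x\<bar> \<le> B" for x
  proof -
    have "\<bar>g x\<bar> \<le> (\<integral>y. \<bar>K (x, y)\<bar> \<partial>?DY)" unfolding g_def by (rule integral_abs_bound)
    also have "\<dots> \<le> B"
      by (intro DY.integral_le_const DY.integrable_const_bound[where B=B]) (auto simp: bounded)
    finally show ?thesis .
  qed
  have "AE \<omega> in M. real_cond_exp M ?F (\<lambda>\<omega>. K (X \<omega>, Y \<omega>)) \<omega> = g (X \<omega>)"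
  proof (rule real_cond_exp_charact)
    show "integrable M (\<lambda>\<omega>. K (X \<omega>, Y \<omega>))" "integrable M (\<lambda>\<omega>. g (X \<omega>))"
      by (rule integrable_const_bound[where B=B]; simp add: bounded g_bound)+
    show "(\<lambda>\<omega>. g (X \<omega>)) \<in> borel_measurable ?F"
      by (rule measurable_compose[OF measurable_vimage_algebra1]) auto
    fix A assume "A \<in> sets ?F"
    then obtain C where A: "A = X -` C \<inter> space M" and [measurable]: "C \<in> sets borel"
      by (auto simp: sets_vimage_algebra2)
    let ?h = "\<lambda>p. indicator C (fst p) * K p :: real"
    have int: "integrable (?DX \<Otimes>\<^sub>M ?DY) ?h"
      by (rule P.integrable_const_bound[where B=B])
         (auto simp: bounded abs_mult indicator_def intro: order_trans[OF abs_ge_zero bounded])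
    have "(\<integral>\<omega>\<in>A. K (X \<omega>, Y \<omega>) \<partial>M) = (\<integral>\<omega>. ?h (X \<omega>, Y \<omega>) \<partial>M)"
      unfolding set_lebesgue_integral_def
      by (rule Bochner_Integration.integral_cong) (auto simp: A indicator_def)
    also have "\<dots> = integral\<^sup>L (distr M (borel \<Otimes>\<^sub>M borel) (\<lambda>\<omega>. (X \<omega>, Y \<omega>))) ?h"
      by (subst integral_distr) auto
    also have "\<dots> = integral\<^sup>L (?DX \<Otimes>\<^sub>M ?DY) ?h"
      using indep by (simp add: indep_var_distribution_eq)
    also have "\<dots> = (\<integral>x. \<integral>y. ?h (x, y) \<partial>?DY \<partial>?DX)"
      by (rule P.integral_fst'[OF int, symmetric])
    also have "\<dots> = (\<integral>x. indicator C x * g x \<partial>?DX)"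
      by (simp add: g_def)
    also have "\<dots> = (\<integral>\<omega>. indicator C (X \<omega>) * g (X \<omega>) \<partial>M)"
      by (subst integral_distr) auto
    also have "\<dots> = (\<integral>\<omega>\<in>A. g (X \<omega>) \<partial>M)"
      unfolding set_lebesgue_integral_def
      by (rule Bochner_Integration.integral_cong) (auto simp: A indicator_def)
    finally show "(\<integral>\<omega>\<in>A. K (X \<omega>, Y \<omega>) \<partial>M) = (\<integral>\<omega>\<in>A. g (X \<omega>) \<partial>M)" .
  qed
  then show ?thesis by (simp add: g_def)
qed

theorem theorem5:
  fixes M :: "'a measure" and r :: "'a \<Rightarrow> real ^ 'd" and q x :: "real ^ 'd" and \<theta> :: real
  assumes "prob_space M"
    and "std_gaussian_vector M r"
    and "norm q = 1" and "norm x = 1"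
    and "\<theta> = arccos (q \<bullet> x)"
    and "\<theta> \<in> {0<..<pi} - {pi / 2}"
  shows "AE \<omega> in M.
    cond_prob_given M (\<lambda>\<omega>. hyperplane_hash (r \<omega>) x \<noteq> hyperplane_hash (r \<omega>) q) (\<lambda>\<omega>. r \<omega> \<bullet> q) \<omega>
      = 1 / 2 - 1 / 2 * erf (\<bar>r \<omega> \<bullet> q\<bar> / (sqrt 2 * tan \<theta>))"
proof -
  interpret prob_space M by fact
  note r = assms(2)
  have qq: "q \<bullet> q = 1" and xx: "x \<bullet> x = 1"
    using assms(3,4) by (simp_all add: norm_eq_1)
  have "\<bar>q \<bullet> x\<bar> \<le> 1"
    using Cauchy_Schwarz_ineq2[of q x] assms(3,4) by simp
  then have cos: "cos \<theta> = q \<bullet> x"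
    by (simp add: assms(5) cos_arccos abs_le_iff)
  have sin: "sin \<theta> > 0"
    using assms(6) by (intro sin_gt_zero) auto
  define w where "w = (1 / sin \<theta>) *\<^sub>R (x - cos \<theta> *\<^sub>R q)"
  have x_eq: "x = cos \<theta> *\<^sub>R q + sin \<theta> *\<^sub>R w"
    using sin by (simp add: w_def)
  have qw: "q \<bullet> w = 0"
    by (simp add: w_def inner_diff_right qq cos)
  have "(x - cos \<theta> *\<^sub>R q) \<bullet> (x - cos \<theta> *\<^sub>R q) = (sin \<theta>)\<^sup>2"
    unfolding sin_squared_eq
    by (simp add: inner_diff_left inner_diff_right qq xx cos inner_commute[of x q] power2_eq_square)
  then have "w \<bullet> w = 1"
    using sin by (simp add: w_def power2_eq_square)
  then have w: "norm w = 1" by (simp add: norm_eq_1)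
  define K :: "real \<times> real \<Rightarrow> real" where
    "K p = of_bool ((cos \<theta> * fst p + sin \<theta> * snd p \<le> 0) \<noteq> (fst p \<le> 0))" for p
  have [measurable]: "K \<in> borel_measurable (borel \<Otimes>\<^sub>M borel)"
    unfolding K_def[abs_def] by measurable
  have [measurable]: "r \<in> borel_measurable M" using r by (rule std_gaussian_vector_measurable)
  have ind: "indicator {\<omega> \<in> space M. hyperplane_hash (r \<omega>) x \<noteq> hyperplane_hash (r \<omega>) q} \<omega>
      = K (r \<omega> \<bullet> q, r \<omega> \<bullet> w)" if "\<omega> \<in> space M" for \<omega>
  proof -
    have "r \<omega> \<bullet> x = cos \<theta> * (r \<omega> \<bullet> q) + sin \<theta> * (r \<omega> \<bullet> w)"
      by (subst x_eq) (simp add: inner_add_right)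
    then show ?thesis
      using that by (auto simp: hyperplane_hash_def K_def)
  qed
  have distr: "distr M borel (\<lambda>\<omega>. r \<omega> \<bullet> w) = std_normal_distribution"
    using std_gaussian_vector_inner_distributed[OF assms(1) r w]
    by (simp add: distributed_def cong: distr_cong)
  have int: "(\<integral>z. K (y, z) \<partial>std_normal_distribution) = 1 / 2 - 1 / 2 * erf (\<bar>y\<bar> / (sqrt 2 * tan \<theta>))" for y
  proof -
    have le: "cos \<theta> * y + sin \<theta> * z \<le> 0 \<longleftrightarrow> z \<le> - (y / tan \<theta>)" for z
      using sin by (simp add: tan_def field_simps) linarith
    have "(\<lambda>z. K (y, z)) = indicator (if y \<le> 0 then {\<bar>y\<bar> / tan \<theta><..} else {.. - (\<bar>y\<bar> / tan \<theta>)})"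
      by (auto simp: fun_eq_iff K_def le indicator_def)
    then show ?thesis
      by (simp add: std_normal_greaterThan std_normal_atMost mult.commute)
  qed
  have "AE \<omega> in M. real_cond_exp M (vimage_algebra (space M) (\<lambda>\<omega>. r \<omega> \<bullet> q) borel)
      (\<lambda>\<omega>. K (r \<omega> \<bullet> q, r \<omega> \<bullet> w)) \<omega> = (\<integral>z. K (r \<omega> \<bullet> q, z) \<partial>distr M borel (\<lambda>\<omega>. r \<omega> \<bullet> w))"
    by (rule real_cond_exp_indep_var[where B=1])
       (simp_all add: std_gaussian_vector_inner_indep[OF assms(1) r assms(3) qw], simp add: K_def)
  moreover have "AE \<omega> in M. cond_prob_given M (\<lambda>\<omega>. hyperplane_hash (r \<omega>) x \<noteq> hyperplane_hash (r \<omega>) q) (\<lambda>\<omega>. r \<omega> \<bullet> q) \<omega>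
     = real_cond_exp M (vimage_algebra (space M) (\<lambda>\<omega>. r \<omega> \<bullet> q) borel) (\<lambda>\<omega>. K (r \<omega> \<bullet> q, r \<omega> \<bullet> w)) \<omega>"
  proof -
    let ?F = "vimage_algebra (space M) (\<lambda>\<omega>. r \<omega> \<bullet> q) borel"
    interpret finite_measure_subalgebra M ?F
      by unfold_locales (auto simp: subalgebra_def sets_vimage_algebra2)
    have "(\<lambda>\<omega>. K (r \<omega> \<bullet> q, r \<omega> \<bullet> w)) \<in> borel_measurable M"
      by measurable
    then have m: "(indicator {\<omega> \<in> space M. hyperplane_hash (r \<omega>) x \<noteq> hyperplane_hash (r \<omega>) q} :: 'a \<Rightarrow> real)
        \<in> borel_measurable M"
      by (rule measurable_cong[THEN iffD2, rotated]) (rule ind)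
    show ?thesis
      unfolding cond_prob_given_def
      by (rule real_cond_exp_cong) (auto intro!: AE_I2 ind m)
  qed
  ultimately show ?thesis
    by eventually_elim (simp only: distr int)
qed

end
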